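(* Let $p\ge1$ and let $\sigma=(\sigma_0,\dots,\sigma_{p-1})\in\{-,+\}^p$ be a periodic slope itinerary with $\sigma_0=-$ and $\sigma_j=+$ for $1\le j\le p-1$. Let $S$ be a connected component of the set of parameters $(a,b)\in\mathbb R/\mathbb Z\times[0,1]$ for which $f_{a,b}$ has an attracting periodic cycle of period $p$ with periodic slope itinerary $\sigma$. For $(a,b)\in S$ let $x_0(a,b)$ be the point of this attracting cycle lying in $I_-$. Then the map $\Xi:S\to\mathbb T$, $\Xi(a,b)=x_0(a,b)$, is continuous.
   Context: Let $\mathbb T=\mathbb R/\mathbb Z$, identified with $[0,1]$ with $0\sim 1$. For $(a,b)\in\mathbb R/\mathbb Z\times[0,1]$ define $f_{a,b}:\mathbb T\to\mathbb T$ by $f_{a,b}(x)=\left(2x+a+\frac b2 S(x)\right)\bmod 1$, where (in this formula) $S(x)=4x-1$ for $x\in[0,\frac12]$ and $S(x)=-4x+3$ for $x\in[\frac12,1)$. Write $I_+=[0,\frac12]$, $I_-=[\frac12,1]$. For a periodic orbit $x_0,\dots,x_{p-1}$ (with $x_{j+1}=f_{a,b}(x_j)$) of exact period $p$ avoiding $0$ and $\frac12$, its periodic slope itinerary is $(\sigma_0,\dots,\sigma_{p-1})$ with $x_j\in I_{\sigma_j}$. A periodic cycle of period $p$ is attracting if each of its points has a neighbourhood all of whose points converge to it under iteration of $f_{a,b}^p$. For each parameter $f_{a,b}$ has at most one attracting cycle. *)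

theory Defs
  imports "HOL-Analysis.Analysis"
begin

quotient_type circle = real / "\<lambda>x y :: real. x - y \<in> \<int>"
proof (rule equivpI)
  show "reflp (\<lambda>x y :: real. x - y \<in> \<int>)"
    by (rule reflpI) simp
  show "symp (\<lambda>x y :: real. x - y \<in> \<int>)"
    by (rule sympI) (metis Ints_minus minus_diff_eq)
  show "transp (\<lambda>x y :: real. x - y \<in> \<int>)"
  proof (rule transpI)
    fix x y z :: real
    assume "x - y \<in> \<int>" "y - z \<in> \<int>"
    then have "(x - y) + (y - z) \<in> \<int>" by (rule Ints_add)
    then show "x - z \<in> \<int>" by simp
  qed
qed

lift_definition to_circle :: "real \<Rightarrow> circle" is "\<lambda>x. x" .

text \<open>The circle carries the quotient topology of the real line.\<close>

instantiation circle :: topological_space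
begin

definition open_circle :: "circle set \<Rightarrow> bool"
  where "open_circle U \<longleftrightarrow> open (to_circle -` U)"

instance
proof
  show "open (UNIV :: circle set)"
    by (simp add: open_circle_def)
  show "open (U \<inter> V)" if "open U" "open V" for U V :: "circle set"
    using that by (simp add: open_circle_def vimage_Int open_Int)
  show "open (\<Union>K)" if "\<forall>U\<in>K. open U" for K :: "circle set set"
    using that by (simp add: open_circle_def vimage_Union open_UN)
qed

end

definition tri :: "real \<Rightarrow> real"
  where "tri t = (if t \<le> 1/2 then 4 * t - 1 else - 4 * t + 3)"

text \<open>
  The maps \<open>f\<^sub>a\<^sub>,\<^sub>b\<close>. The piecewise affine function \<^const>\<open>tri\<close> is only meant on \<open>[0,1)\<close>, so it
  is evaluated at the representative \<^term>\<open>frac x\<close>.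
\<close>

lift_definition circle_map :: "circle \<Rightarrow> real \<Rightarrow> circle \<Rightarrow> circle"
  is "\<lambda>a b x. 2 * x + a + b / 2 * tri (frac x)"
proof -
  fix a a' b x x' :: real
  assume a: "a - a' \<in> \<int>" and x: "x - x' \<in> \<int>"
  from x obtain n :: int where n: "x - x' = of_int n" by (auto elim: Ints_cases)
  then have "x = x' + of_int n" by simp
  then have "frac x = frac x'" by (simp add: frac_def)
  then have "2 * x + a + b / 2 * tri (frac x) - (2 * x' + a' + b / 2 * tri (frac x'))
      = of_int (2 * n) + (a - a')"
    using n by (simp add: algebra_simps)
  also have "\<dots> \<in> \<int>" using a by (intro Ints_add Ints_of_int)
  finally show "2 * x + a + b / 2 * tri (frac x) - (2 * x' + a' + b / 2 * tri (frac x')) \<in> \<int>" .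
qed

datatype slope = Minus | Plus

fun slope_arc :: "slope \<Rightarrow> circle set"
  where
    "slope_arc Plus = to_circle ` {0..1/2}"
  | "slope_arc Minus = to_circle ` {1/2..1}"

definition exact_period :: "('a \<Rightarrow> 'a) \<Rightarrow> nat \<Rightarrow> 'a \<Rightarrow> bool"
  where "exact_period f p x \<longleftrightarrow>
    p > 0 \<and> (f ^^ p) x = x \<and> (\<forall>j. 0 < j \<and> j < p \<longrightarrow> (f ^^ j) x \<noteq> x)"

definition cycle_of :: "('a \<Rightarrow> 'a) \<Rightarrow> nat \<Rightarrow> 'a \<Rightarrow> 'a set"
  where "cycle_of f p x = (\<lambda>j. (f ^^ j) x) ` {..<p}"

definition periodic_cycle :: "('a \<Rightarrow> 'a) \<Rightarrow> nat \<Rightarrow> 'a set \<Rightarrow> bool"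
  where "periodic_cycle f p C \<longleftrightarrow> (\<exists>x. exact_period f p x \<and> C = cycle_of f p x)"

definition attracting_cycle :: "('a::topological_space \<Rightarrow> 'a) \<Rightarrow> nat \<Rightarrow> 'a set \<Rightarrow> bool"
  where "attracting_cycle f p C \<longleftrightarrow> periodic_cycle f p C \<and>
    (\<forall>z\<in>C. \<exists>U. open U \<and> z \<in> U \<and> (\<forall>y\<in>U. (\<lambda>n. ((f ^^ p) ^^ n) y) \<longlonglongrightarrow> z))"

definition slope_itinerary :: "(circle \<Rightarrow> circle) \<Rightarrow> circle \<Rightarrow> slope list \<Rightarrow> bool"
  where "slope_itinerary f x \<sigma> \<longleftrightarrow> exact_period f (length \<sigma>) x \<and>
    (\<forall>j<length \<sigma>. (f ^^ j) x \<notin> {to_circle 0, to_circle (1/2)} \<and>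
                   (f ^^ j) x \<in> slope_arc (\<sigma> ! j))"

text \<open>
  The itinerary of a cycle depends on the choice of the initial point; a cycle has itinerary
  \<open>\<sigma>\<close> if one of its points may be taken as initial point.
\<close>

definition attracting_cycle_with :: "circle \<times> real \<Rightarrow> nat \<Rightarrow> slope list \<Rightarrow> circle set \<Rightarrow> bool"
  where "attracting_cycle_with = (\<lambda>(a, b) p \<sigma> C.
    attracting_cycle (circle_map a b) p C \<and>
    (\<exists>x\<in>C. slope_itinerary (circle_map a b) x \<sigma>))"

definition attracting_params :: "nat \<Rightarrow> slope list \<Rightarrow> (circle \<times> real) set"
  where "attracting_params p \<sigma> =
    {(a, b). 0 \<le> b \<and> b \<le> 1 \<and> (\<exists>C. attracting_cycle_with (a, b) p \<sigma> C)}"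

end

theory Submission
  imports Defs
begin

text \<open>
  Two orbits with the same slope itinerary are compared through their representatives in \<open>(0,1)\<close>,
  possibly for two different parameters. At each time the two points lie in the same open half of
  the circle, so the difference \<open>e\<^sub>j\<close> of the representatives is smaller than \<open>1/2\<close> in absolute value.
  On this half both maps are affine, hence \<open>e\<^sub>j\<^sub>+\<^sub>1 = m\<^sub>j e\<^sub>j + d\<^sub>j\<close> modulo 1, where \<open>m\<^sub>j\<close> is the slope and
  \<open>d\<^sub>j\<close> is of the size \<open>\<eta>\<close> of the parameter change.

  The point of the itinerary \<open>- + \<dots> +\<close> is that no integer jump ever occurs in this recursion. If the
  cycle is attracting then its multiplier \<open>\<Lambda> = (2 - 2b)(2 + 2b)\<^sup>p\<^sup>-\<^sup>1\<close> is smaller than 1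
  (\<open>attracting_multiplier_less_1\<close>). All factors but the first are at least 1, so every partial product is
  at most \<open>\<Lambda>\<close> (\<open>multiplier_mono\<close>), and \<open>m\<^sub>j e\<^sub>j + d\<^sub>j\<close> itself has absolute value below \<open>1/2\<close> once \<open>\<eta>\<close> is
  small. Two reals in \<open>(-1/2, 1/2)\<close> that agree modulo 1 are equal, so the recursion is an equality
  of reals (\<open>offset_tracking\<close>). Going once around the cycle gives
  \<open>e\<^sub>0 = \<Lambda> e\<^sub>0 + O(\<eta>)\<close>, that is \<open>(1 - \<Lambda>) \<bar>e\<^sub>0\<bar> = O(\<eta>)\<close> (\<open>itinerary_point_perturbation\<close>), which is the
  continuity of the marked point. The same estimate with \<open>\<eta> = 0\<close> shows that a parameter has only one
  attracting cycle with this itinerary.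
\<close>

section \<open>The circle as a quotient\<close>

lemma to_circle_eq_iff: "to_circle s = to_circle t \<longleftrightarrow> s - t \<in> \<int>"
  by transfer (rule refl)

lemma Ints_abs_less_1: "x - y \<in> \<int> \<Longrightarrow> \<bar>x - y\<bar> < 1 \<Longrightarrow> x = (y::real)"
  using Ints_nonzero_abs_less1[of "x - y"] by (metis not_less_iff_gr_or_eq right_minus_eq)

lemma frac_eq_if_diff_Ints:
  fixes x y :: real
  assumes "x - y \<in> \<int>"
  shows "frac x = frac y"
proof -
  from assms obtain n :: int where "x - y = of_int n" by (auto elim: Ints_cases)
  then have "x = y + of_int n" by simp
  then show ?thesis by (simp add: frac_def)
qed

lift_definition circle_rep :: "circle \<Rightarrow> real" is frac
  by (rule frac_eq_if_diff_Ints)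

lemma to_circle_rep [simp]: "to_circle (circle_rep x) = x"
  by transfer (simp add: frac_def)

lemma circle_rep_to_circle: "0 \<le> t \<Longrightarrow> t < 1 \<Longrightarrow> circle_rep (to_circle t) = t"
  by transfer (simp add: frac_eq)

lemma open_to_circle_image:
  assumes "open A"
  shows "open (to_circle ` A)"
proof -
  have "to_circle -` to_circle ` A = (\<Union>n::int. (+) (of_int n) ` A)"
  proof (intro equalityI subsetI)
    fix t assume "t \<in> to_circle -` to_circle ` A"
    then obtain s where s: "s \<in> A" "t - s \<in> \<int>"
      by (auto simp: to_circle_eq_iff)
    then obtain n where "t - s = of_int n" by (auto elim: Ints_cases)
    then have "t = of_int n + s" by simp
    with s show "t \<in> (\<Union>n::int. (+) (of_int n) ` A)" by blast
  next
    fix t assume "t \<in> (\<Union>n::int. (+) (of_int n) ` A)"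
    then obtain n :: int and s where s: "s \<in> A" "t = of_int n + s" by blast
    then have "to_circle t = to_circle s" by (simp add: to_circle_eq_iff)
    with s show "t \<in> to_circle -` to_circle ` A" by auto
  qed
  then show ?thesis
    using assms by (auto simp: open_circle_def intro!: open_translation)
qed

lemma open_circle_contains_arc:
  assumes "open U" "to_circle t \<in> U"
  obtains \<epsilon> where "\<epsilon> > 0" "\<And>s. \<bar>s - t\<bar> < \<epsilon> \<Longrightarrow> to_circle s \<in> U"
proof -
  from assms have "open (to_circle -` U)" "t \<in> to_circle -` U"
    by (auto simp: open_circle_def)
  then show ?thesis
    using that by (auto simp: open_dist dist_real_def)
qed

section \<open>Lifts and affine branches\<close>

definition circle_lift :: "real \<Rightarrow> real \<Rightarrow> real \<Rightarrow> real"
  where "circle_lift a b x = 2 * x + a + b / 2 * tri (frac x)"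

lemma circle_map_to_circle:
  "circle_map (to_circle a) b (to_circle x) = to_circle (circle_lift a b x)"
  unfolding circle_lift_def by transfer simp

text \<open>
  On the half with sign \<open>s\<close> the lift is \<open>t \<mapsto> branch_slope b s * t + branch_offset b s + a\<close>.
\<close>

fun branch_slope :: "real \<Rightarrow> slope \<Rightarrow> real"
  where
    "branch_slope b Plus = 2 + 2 * b"
  | "branch_slope b Minus = 2 - 2 * b"

fun branch_offset :: "real \<Rightarrow> slope \<Rightarrow> real"
  where
    "branch_offset b Plus = - b / 2"
  | "branch_offset b Minus = 3 * b / 2"

fun open_arc :: "slope \<Rightarrow> real set"
  where
    "open_arc Plus = {0<..<1/2}"
  | "open_arc Minus = {1/2<..<1}"

lemma circle_lift_branch:
  assumes "t \<in> open_arc s"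
  shows "circle_lift a b t = branch_slope b s * t + branch_offset b s + a"
  using assms by (cases s) (auto simp: circle_lift_def tri_def frac_eq field_simps)

lemma open_open_arc: "open (open_arc s)"
  by (cases s) auto

lemma open_arc_diff: "s \<in> open_arc i \<Longrightarrow> t \<in> open_arc i \<Longrightarrow> \<bar>s - t\<bar> < 1/2"
  by (cases i) (auto simp: abs_if)

lemma open_arc_bounds: "t \<in> open_arc i \<Longrightarrow> 0 < t \<and> t < 1"
  by (cases i) auto

lemma circle_rep_in_open_arc:
  assumes "x \<in> slope_arc s" "x \<notin> {to_circle 0, to_circle (1/2)}"
  shows "circle_rep x \<in> open_arc s"
proof (cases s)
  case Plus
  with assms obtain t where t: "0 \<le> t" "t \<le> 1/2" "x = to_circle t" by auto
  from t(3) assms(2) have "t \<noteq> 0" "t \<noteq> 1/2" by blast+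
  with t Plus show ?thesis by (simp add: circle_rep_to_circle)
next
  case Minus
  with assms obtain t where t: "1/2 \<le> t" "t \<le> 1" "x = to_circle t" by auto
  have "to_circle 1 = to_circle 0" by (simp add: to_circle_eq_iff)
  with t(3) assms(2) have "t \<noteq> 1" "t \<noteq> 1/2" by (metis insertCI)+
  with t Minus show ?thesis by (simp add: circle_rep_to_circle)
qed

lemma slope_arcs_disjoint:
  assumes "x \<in> slope_arc Plus" "x \<in> slope_arc Minus"
  shows "x \<in> {to_circle 0, to_circle (1/2)}"
  using circle_rep_in_open_arc[of x Plus] circle_rep_in_open_arc[of x Minus] assms by fastforce

definition multiplier :: "real \<Rightarrow> slope list \<Rightarrow> nat \<Rightarrow> real"
  where "multiplier b \<sigma> j = (\<Prod>i<j. branch_slope b (\<sigma> ! i))"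

lemma multiplier_0 [simp]: "multiplier b \<sigma> 0 = 1"
  by (simp add: multiplier_def)

lemma multiplier_Suc: "multiplier b \<sigma> (Suc j) = branch_slope b (\<sigma> ! j) * multiplier b \<sigma> j"
  by (simp add: multiplier_def)

lemma branch_slope_nonneg: "0 \<le> b \<Longrightarrow> b \<le> 1 \<Longrightarrow> 0 \<le> branch_slope b s"
  by (cases s) auto

lemma multiplier_nonneg: "0 \<le> b \<Longrightarrow> b \<le> 1 \<Longrightarrow> 0 \<le> multiplier b \<sigma> j"
  by (simp add: multiplier_def prod_nonneg branch_slope_nonneg)

definition orbit_rep :: "circle \<Rightarrow> real \<Rightarrow> circle \<Rightarrow> nat \<Rightarrow> real"
  where "orbit_rep a b x j = circle_rep ((circle_map a b ^^ j) x)"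

lemma to_circle_orbit_rep: "to_circle (orbit_rep a b x j) = (circle_map a b ^^ j) x"
  by (simp add: orbit_rep_def)

lemma orbit_rep_in_open_arc:
  assumes "slope_itinerary (circle_map a b) x \<sigma>" "j < length \<sigma>"
  shows "orbit_rep a b x j \<in> open_arc (\<sigma> ! j)"
  using assms by (auto simp: slope_itinerary_def orbit_rep_def intro!: circle_rep_in_open_arc)

lemma orbit_rep_period:
  assumes "slope_itinerary (circle_map a b) x \<sigma>"
  shows "orbit_rep a b x (length \<sigma>) = orbit_rep a b x 0"
  using assms by (simp add: slope_itinerary_def exact_period_def orbit_rep_def)

lemma orbit_rep_Suc:
  assumes "slope_itinerary (circle_map (to_circle a) b) x \<sigma>" "j < length \<sigma>"
  shows "orbit_rep (to_circle a) b x (Suc j)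
    - (branch_slope b (\<sigma> ! j) * orbit_rep (to_circle a) b x j + branch_offset b (\<sigma> ! j) + a) \<in> \<int>"
proof -
  let ?r = "orbit_rep (to_circle a) b x"
  have "to_circle (?r (Suc j)) = circle_map (to_circle a) b (to_circle (?r j))"
    by (simp add: to_circle_orbit_rep)
  then show ?thesis
    using circle_lift_branch[OF orbit_rep_in_open_arc[OF assms]]
    by (simp add: circle_map_to_circle to_circle_eq_iff)
qed

text \<open>
  As long as a perturbed point stays on the halves prescribed by the itinerary, only the affine
  branches act, and the perturbation gets multiplied by their slopes.
\<close>

lemma orbit_near_itinerary:
  assumes itin: "slope_itinerary (circle_map (to_circle a) b) x \<sigma>"
    and arc: "\<And>j. j < length \<sigma> \<Longrightarrow>
      orbit_rep (to_circle a) b x j + multiplier b \<sigma> j * u \<in> open_arc (\<sigma> ! j)"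
    and "j \<le> length \<sigma>"
  shows "(circle_map (to_circle a) b ^^ j) (to_circle (orbit_rep (to_circle a) b x 0 + u))
    = to_circle (orbit_rep (to_circle a) b x j + multiplier b \<sigma> j * u)"
  using assms(3)
proof (induction j)
  case 0
  then show ?case by simp
next
  case (Suc j)
  then have j: "j < length \<sigma>" by simp
  have "(circle_map (to_circle a) b ^^ Suc j) (to_circle (orbit_rep (to_circle a) b x 0 + u))
    = circle_map (to_circle a) b
        (to_circle (orbit_rep (to_circle a) b x j + multiplier b \<sigma> j * u))"
    using Suc by simp
  also have "\<dots> = to_circle (orbit_rep (to_circle a) b x (Suc j) + multiplier b \<sigma> (Suc j) * u)"
    unfolding circle_map_to_circle circle_lift_branch[OF arc[OF j]] to_circle_eq_iff
    using Ints_minus[OF orbit_rep_Suc[OF itin j]] by (simp add: multiplier_Suc algebra_simps)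
  finally show ?case .
qed

section \<open>The multiplier of an attracting cycle\<close>

text \<open>
  For \<open>b < 1\<close> neither branch is constant, so an equation \<open>F(t) = v\<close> has at most two solutions with a
  given integer part.
\<close>

lemma countable_circle_lift_vimage:
  assumes "countable A" "0 \<le> b" "b < 1"
  shows "countable (circle_lift a b -` A)"
proof -
  define L where "L v k = (v - a + b/2 * (4 * k + 1)) / (2 + 2 * b)" for v k
  define R where "R v k = (v - a - b/2 * (4 * k + 3)) / (2 - 2 * b)" for v k
  let ?T = "\<Union>v\<in>A. \<Union>k::int. {L v k, R v k}"
  have "circle_lift a b -` A \<subseteq> ?T"
  proof
    fix t assume t: "t \<in> circle_lift a b -` A"
    define k :: real where "k = of_int \<lfloor>t\<rfloor>"
    have frac: "frac t = t - k" by (simp add: frac_def k_def)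
    have "t \<in> {L (circle_lift a b t) k, R (circle_lift a b t) k}"
    proof (cases "frac t \<le> 1/2")
      case True
      then have F: "circle_lift a b t = 2 * t + a + b/2 * (4 * (t - k) - 1)"
        by (simp only: circle_lift_def tri_def if_True frac)
      have "(2 + 2 * b) * t = circle_lift a b t - a + b/2 * (4 * k + 1)"
        unfolding F by (simp add: field_simps)
      then have "t = L (circle_lift a b t) k"
        using assms(2) by (simp add: L_def eq_divide_eq mult.commute)
      then show ?thesis by (metis insertI1)
    next
      case False
      then have F: "circle_lift a b t = 2 * t + a + b/2 * (- 4 * (t - k) + 3)"
        by (simp only: circle_lift_def tri_def if_False frac)
      have "(2 - 2 * b) * t = circle_lift a b t - a - b/2 * (4 * k + 3)"
        unfolding F by (simp add: field_simps)
      then have "t = R (circle_lift a b t) k"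
        using assms(3) by (simp add: R_def eq_divide_eq mult.commute)
      then show ?thesis by (metis insertI1 insertI2)
    qed
    then have "t \<in> (\<Union>k::int. {L (circle_lift a b t) k, R (circle_lift a b t) k})"
      unfolding k_def by (rule UN_I[OF UNIV_I])
    moreover have "circle_lift a b t \<in> A" using t by (rule vimageD)
    ultimately show "t \<in> ?T" by (rule UN_I[rotated])
  qed
  moreover have "countable ?T"
    using assms(1) by (intro countable_UN countable_insert countable_empty countableI_type)
  ultimately show ?thesis by (rule countable_subset)
qed

text \<open>
  A cycle of multiplier at least 1 could still capture nearby points that first move away and later
  land exactly on it. Countability shows that these are too few to fill a neighbourhood.
\<close>

lemma countable_preorbit:
  assumes "0 \<le> b" "b < 1"
  shows "countable {t. \<exists>n. (circle_map a b ^^ n) (to_circle t) = x}"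
proof -
  obtain \<alpha> where \<alpha>: "a = to_circle \<alpha>" by (metis to_circle_rep)
  have "countable {t. (circle_map a b ^^ n) (to_circle t) = x}" for n
  proof (induction n)
    case 0
    have "{t. to_circle t = x} \<subseteq> range (\<lambda>n::int. circle_rep x + of_int n)"
    proof
      fix t assume "t \<in> {t. to_circle t = x}"
      then have "to_circle t = to_circle (circle_rep x)" by simp
      then have "t - circle_rep x \<in> \<int>" by (simp only: to_circle_eq_iff)
      then obtain n where "t - circle_rep x = of_int n" by (auto elim: Ints_cases)
      then have "t = circle_rep x + of_int n" by simp
      then show "t \<in> range (\<lambda>n::int. circle_rep x + of_int n)" by blast
    qed
    then have "countable {t. to_circle t = x}" by (rule countable_subset) simp
    then show ?case by simp
  next
    case (Suc n)
    have "{t. (circle_map a b ^^ Suc n) (to_circle t) = x}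
      = circle_lift \<alpha> b -` {t. (circle_map a b ^^ n) (to_circle t) = x}"
      unfolding funpow_Suc_right o_apply \<alpha> circle_map_to_circle by blast
    then show ?case using countable_circle_lift_vimage[OF Suc assms] by simp
  qed
  then have "countable (\<Union>n. {t. (circle_map a b ^^ n) (to_circle t) = x})" by auto
  also have "(\<Union>n. {t. (circle_map a b ^^ n) (to_circle t) = x})
    = {t. \<exists>n. (circle_map a b ^^ n) (to_circle t) = x}" by auto
  finally show ?thesis .
qed

text \<open>
  Let \<open>y\<close> be a point of the neighbourhood that never lands on \<open>x\<close>. Once its orbit under the first
  return map remains close to \<open>x\<close>, the signed distance to \<open>x\<close> is multiplied by \<open>\<Lambda>\<close> in every step; if
  \<open>\<Lambda> \<ge> 1\<close>, then its absolute value does not decrease, and being nonzero it cannot tend to 0. The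
  assumption \<open>b < 1\<close> provides \<open>y\<close>: for \<open>b = 1\<close> the branch on \<open>I\<^sub>-\<close> is constant, and the preorbit of \<open>x\<close>
  may contain intervals.
\<close>

lemma attracting_multiplier_less_1:
  assumes itin: "slope_itinerary (circle_map a b) x \<sigma>"
    and b: "0 \<le> b" "b < 1"
    and U: "open U" "x \<in> U"
    and conv: "\<And>y. y \<in> U \<Longrightarrow> (\<lambda>n. ((circle_map a b ^^ length \<sigma>) ^^ n) y) \<longlonglongrightarrow> x"
  shows "multiplier b \<sigma> (length \<sigma>) < 1"
proof (rule ccontr)
  define \<Lambda> where "\<Lambda> = multiplier b \<sigma> (length \<sigma>)"
  assume "\<not> ?thesis"
  then have \<Lambda>: "\<Lambda> \<ge> 1" by (simp add: \<Lambda>_def)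
  obtain \<alpha> where \<alpha>: "a = to_circle \<alpha>" by (metis to_circle_rep)
  define r where "r = orbit_rep a b x"
  define g where "g = circle_map a b ^^ length \<sigma>"
  have x: "x = to_circle (r 0)" by (simp add: r_def to_circle_orbit_rep)
  have "\<forall>\<^sub>F u in nhds 0. \<forall>j\<in>{..<length \<sigma>}. r j + multiplier b \<sigma> j * u \<in> open_arc (\<sigma> ! j)"
  proof (rule eventually_ball_finite; intro ballI finite_lessThan)
    fix j assume "j \<in> {..<length \<sigma>}"
    then have "r j + multiplier b \<sigma> j * 0 \<in> open_arc (\<sigma> ! j)"
      using orbit_rep_in_open_arc[OF itin] by (simp add: r_def)
    moreover have "((\<lambda>u. r j + multiplier b \<sigma> j * u) \<longlongrightarrow> r j + multiplier b \<sigma> j * 0) (nhds 0)"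
      by (intro tendsto_intros filterlim_ident)
    ultimately show "\<forall>\<^sub>F u in nhds 0. r j + multiplier b \<sigma> j * u \<in> open_arc (\<sigma> ! j)"
      using open_open_arc by (rule topological_tendstoD[rotated 2])
  qed
  then obtain \<delta>' where \<delta>': "\<delta>' > 0" "\<And>u j. \<bar>u\<bar> < \<delta>' \<Longrightarrow> j < length \<sigma> \<Longrightarrow>
      r j + multiplier b \<sigma> j * u \<in> open_arc (\<sigma> ! j)"
    by (auto simp: eventually_nhds_metric dist_real_def)
  \<comment> \<open>The bound \<open>(\<Lambda> + 1) \<delta> \<le> 1\<close> makes the offsets of the image computed by \<open>g\<close> and of a point of the
    \<open>\<delta>\<close>-arc comparable as real numbers.\<close>
  define \<delta> where "\<delta> = min \<delta>' (1 / (\<Lambda> + 1))"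
  have \<delta>: "\<delta> > 0" "\<delta> \<le> \<delta>'" "(\<Lambda> + 1) * \<delta> \<le> 1"
    using \<delta>' \<Lambda> by (auto simp: \<delta>_def min_def field_simps)
  have two: "2 * \<delta> \<le> 1"
    using mult_right_mono[of 2 "\<Lambda> + 1" \<delta>] \<Lambda> \<delta> by linarith
  have g: "g (to_circle (r 0 + u)) = to_circle (r 0 + \<Lambda> * u)" if "\<bar>u\<bar> < \<delta>" for u
    using orbit_near_itinerary[OF itin[unfolded \<alpha>], of u "length \<sigma>"] \<delta>'(2)[of u] that \<delta>(2)
      orbit_rep_period[OF itin]
    by (simp add: g_def \<Lambda>_def r_def \<alpha>)
  obtain \<epsilon> where \<epsilon>: "\<epsilon> > 0" "\<And>s. \<bar>s - r 0\<bar> < \<epsilon> \<Longrightarrow> to_circle s \<in> U"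
    using open_circle_contains_arc[of U "r 0"] U x by blast
  define B where "B = {t. \<exists>n. (circle_map a b ^^ n) (to_circle t) = x}"
  have "countable B" unfolding B_def by (rule countable_preorbit[OF b])
  moreover have "uncountable {r 0 - \<epsilon> <..< r 0 + \<epsilon>}" using \<epsilon>(1) by (simp add: uncountable_open_interval)
  ultimately have "\<not> {r 0 - \<epsilon> <..< r 0 + \<epsilon>} \<subseteq> B"
    by (meson countable_subset)
  then obtain t where t_in: "t \<in> {r 0 - \<epsilon> <..< r 0 + \<epsilon>}" and "t \<notin> B"
    by (meson subsetI)
  then have t_ne: "(circle_map a b ^^ n) (to_circle t) \<noteq> x" for n
    by (simp add: B_def)
  from t_in have t: "\<bar>t - r 0\<bar> < \<epsilon>" by (auto simp: abs_if)
  define y where "y n = (g ^^ n) (to_circle t)" for n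
  have y_lim: "y \<longlonglongrightarrow> x" using conv[OF \<epsilon>(2)[OF t]] by (simp add: y_def[abs_def] g_def)
  have y_ne: "y n \<noteq> x" for n using t_ne by (simp add: y_def g_def funpow_mult)
  have near: "\<exists>N. \<forall>n\<ge>N. \<exists>u. \<bar>u\<bar> < \<eta> \<and> y n = to_circle (r 0 + u)" if "\<eta> > 0" for \<eta>
  proof -
    have "open (to_circle ` {r 0 - \<eta> <..< r 0 + \<eta>})" by (simp add: open_to_circle_image)
    moreover have "x \<in> to_circle ` {r 0 - \<eta> <..< r 0 + \<eta>}" using x that by auto
    ultimately have "\<forall>\<^sub>F n in sequentially. y n \<in> to_circle ` {r 0 - \<eta> <..< r 0 + \<eta>}"
      using y_lim by (simp add: tendsto_def)
    then obtain N where N: "\<And>n. n \<ge> N \<Longrightarrow> y n \<in> to_circle ` {r 0 - \<eta> <..< r 0 + \<eta>}"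
      by (auto simp: eventually_sequentially)
    have "\<exists>u. \<bar>u\<bar> < \<eta> \<and> y n = to_circle (r 0 + u)" if "n \<ge> N" for n
    proof -
      from N[OF that] obtain s where "s \<in> {r 0 - \<eta> <..< r 0 + \<eta>}" "y n = to_circle s" by blast
      then show ?thesis by (intro exI[of _ "s - r 0"]) auto
    qed
    then show ?thesis by blast
  qed
  obtain N where N: "\<And>n. n \<ge> N \<Longrightarrow> \<exists>u. \<bar>u\<bar> < \<delta> \<and> y n = to_circle (r 0 + u)"
    using near[OF \<delta>(1)] by blast
  obtain v where v: "\<bar>v\<bar> < \<delta>" "y N = to_circle (r 0 + v)" using N by blast
  have "v \<noteq> 0" using v(2) y_ne[of N] x by auto
  then obtain M where M: "\<And>n. n \<ge> M \<Longrightarrow> \<exists>u. \<bar>u\<bar> < \<bar>v\<bar> \<and> y n = to_circle (r 0 + u)"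
    using near[of "\<bar>v\<bar>"] by auto
  have grow: "\<exists>w. \<bar>v\<bar> \<le> \<bar>w\<bar> \<and> \<bar>w\<bar> < \<delta> \<and> y (N + k) = to_circle (r 0 + w)" for k
  proof (induction k)
    case 0
    then show ?case using v by auto
  next
    case (Suc k)
    then obtain w where w: "\<bar>v\<bar> \<le> \<bar>w\<bar>" "\<bar>w\<bar> < \<delta>" "y (N + k) = to_circle (r 0 + w)" by blast
    obtain w' where w': "\<bar>w'\<bar> < \<delta>" "y (N + Suc k) = to_circle (r 0 + w')"
      using N[of "N + Suc k"] by auto
    have "y (N + Suc k) = g (y (N + k))" by (simp add: y_def)
    also have "\<dots> = to_circle (r 0 + \<Lambda> * w)" using w g by simp
    finally have "to_circle (r 0 + w') = to_circle (r 0 + \<Lambda> * w)" using w' by simp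
    then have "w' - \<Lambda> * w \<in> \<int>" by (simp only: to_circle_eq_iff add_diff_cancel_left)
    moreover have "\<bar>w' - \<Lambda> * w\<bar> < 1"
    proof -
      have "\<bar>\<Lambda> * w\<bar> \<le> \<Lambda> * \<delta>" using w(2) \<Lambda> by (simp add: abs_mult mult_left_mono)
      moreover have "\<Lambda> * \<delta> + \<delta> \<le> 1" using \<delta>(3) by (simp add: distrib_right)
      ultimately show ?thesis using w'(1) by linarith
    qed
    ultimately have eq: "w' = \<Lambda> * w" by (rule Ints_abs_less_1)
    have "\<bar>w'\<bar> = \<Lambda> * \<bar>w\<bar>" using \<Lambda> by (simp add: eq abs_mult)
    then have "\<bar>v\<bar> \<le> \<bar>w'\<bar>" using \<Lambda> mult_right_mono[of 1 \<Lambda> "\<bar>w\<bar>"] w(1) by linarith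
    with w' show ?case by blast
  qed
  obtain w where w: "\<bar>v\<bar> \<le> \<bar>w\<bar>" "\<bar>w\<bar> < \<delta>" "y (N + M) = to_circle (r 0 + w)"
    using grow[of M] by blast
  obtain u where u: "\<bar>u\<bar> < \<bar>v\<bar>" "y (N + M) = to_circle (r 0 + u)" using M[of "N + M"] le_add2 by blast
  have "to_circle (r 0 + u) = to_circle (r 0 + w)" using w(3) u(2) by simp
  then have "u - w \<in> \<int>" by (simp only: to_circle_eq_iff add_diff_cancel_left)
  moreover have "\<bar>u - w\<bar> < 1" using u(1) w(1,2) two by linarith
  ultimately have "u = w" by (rule Ints_abs_less_1)
  then show False using u(1) w(1) by simp
qed

section \<open>Dependence on the parameters\<close>

text \<open>
  The solution of \<open>e\<^sub>j\<^sub>+\<^sub>1 = m\<^sub>j e\<^sub>j + d\<^sub>j\<close> differs from that of the homogeneous recursion by at most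
  \<open>5\<^sup>j \<kappa>\<close>, because \<open>4 \<cdot> 5\<^sup>j + 1 \<le> 5\<^sup>j\<^sup>+\<^sup>1\<close>. The recursion is only given modulo 1. It is exact since the right
  hand side is at most \<open>\<Lambda>/2 + 5\<^sup>p \<kappa> < 1/2\<close> in absolute value, by the error bound obtained so far.
\<close>

lemma offset_tracking:
  fixes e d m P :: "nat \<Rightarrow> real"
  assumes e: "\<And>j. j \<le> p \<Longrightarrow> \<bar>e j\<bar> < 1/2"
    and rec: "\<And>j. j < p \<Longrightarrow> e (Suc j) - (m j * e j + d j) \<in> \<int>"
    and m: "\<And>j. j < p \<Longrightarrow> 0 \<le> m j \<and> m j \<le> 4"
    and d: "\<And>j. j < p \<Longrightarrow> \<bar>d j\<bar> \<le> \<kappa>"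
    and P: "P 0 = 1" "\<And>j. j < p \<Longrightarrow> P (Suc j) = m j * P j"
    and P_le: "\<And>j. j < p \<Longrightarrow> 0 \<le> P (Suc j) \<and> P (Suc j) \<le> \<Lambda>"
    and \<kappa>: "0 \<le> \<kappa>" "5 ^ p * \<kappa> < (1 - \<Lambda>) / 2"
    and "j \<le> p"
  shows "\<bar>e j - P j * e 0\<bar> \<le> 5 ^ j * \<kappa>"
  using \<open>j \<le> p\<close>
proof (induction j)
  case 0
  then show ?case using P \<kappa> by simp
next
  case (Suc j)
  then have j: "j < p" by simp
  let ?D = "m j * e j + d j"
  have IH: "\<bar>e j - P j * e 0\<bar> \<le> 5 ^ j * \<kappa>" using Suc by simp
  have "?D - P (Suc j) * e 0 = m j * (e j - P j * e 0) + d j"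
    using P(2)[OF j] by (simp add: algebra_simps)
  also have "\<bar>\<dots>\<bar> \<le> m j * \<bar>e j - P j * e 0\<bar> + \<kappa>"
    using m[OF j] d[OF j] abs_triangle_ineq[of "m j * (e j - P j * e 0)" "d j"]
    by (simp add: abs_mult)
  also have "\<dots> \<le> 4 * (5 ^ j * \<kappa>) + 5 ^ j * \<kappa>"
    using mult_mono[of "m j" 4 "\<bar>e j - P j * e 0\<bar>" "5 ^ j * \<kappa>"] m[OF j] IH
      mult_right_mono[of 1 "5 ^ j" \<kappa>] \<kappa>(1) by (simp add: mult.commute)
  also have "\<dots> = 5 ^ Suc j * \<kappa>" by simp
  finally have D: "\<bar>?D - P (Suc j) * e 0\<bar> \<le> 5 ^ Suc j * \<kappa>" .
  have "5 ^ Suc j * \<kappa> \<le> 5 ^ p * \<kappa>"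
    using j \<kappa>(1) by (intro mult_right_mono power_increasing) auto
  moreover have "\<bar>P (Suc j) * e 0\<bar> \<le> \<Lambda> / 2"
    using mult_mono[of "P (Suc j)" \<Lambda> "\<bar>e 0\<bar>" "1/2"] P_le[OF j] e[of 0] by (simp add: abs_mult)
  ultimately have "\<bar>?D\<bar> < 1/2" using D \<kappa>(2) by argo
  moreover have "\<bar>e (Suc j)\<bar> < 1/2" using e Suc.prems by blast
  ultimately have "e (Suc j) = ?D"
    by (intro Ints_abs_less_1[OF rec[OF j]]) linarith
  with D show ?case by simp
qed

text \<open>
  The parameter \<open>b\<close> enters a branch with the coefficient \<open>2t - 1/2\<close> or \<open>3/2 - 2t\<close>, of size at most 2.
\<close>

lemma branch_perturbation:
  assumes "\<bar>a' - a\<bar> \<le> \<eta>" "\<bar>b' - b\<bar> \<le> \<eta>" "0 \<le> t" "t \<le> 1"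
  shows "\<bar>(branch_slope b' s * t + branch_offset b' s + a') - (branch_slope b s * t + branch_offset b s + a)\<bar>
    \<le> 3 * \<eta>"
proof -
  define w where "w = (case s of Plus \<Rightarrow> 2 * t - 1/2 | Minus \<Rightarrow> 3/2 - 2 * t)"
  have "\<bar>w\<bar> \<le> 2" using assms(3,4) by (auto simp: w_def split: slope.split)
  then have "\<bar>(b' - b) * w\<bar> \<le> 2 * \<eta>"
    using mult_mono[of "\<bar>b' - b\<bar>" \<eta> "\<bar>w\<bar>" 2] assms(2) by (simp add: abs_mult mult.commute)
  moreover have "(branch_slope b' s * t + branch_offset b' s + a')
      - (branch_slope b s * t + branch_offset b s + a) = (b' - b) * w + (a' - a)"
    by (cases s) (simp_all add: w_def field_simps)
  ultimately show ?thesis using assms(1) by linarith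
qed

text \<open>
  In the recursion for \<open>e\<^sub>j\<close> the slopes are those of the unprimed map, the change of slope being part of
  \<open>d\<^sub>j\<close>. So the constants depend on \<open>(a, b)\<close> alone, and no bound on the multiplier has to be uniform
  in a neighbourhood of \<open>(a, b)\<close>.
\<close>

lemma itinerary_point_perturbation:
  assumes itin: "slope_itinerary (circle_map (to_circle a) b) x \<sigma>"
    and itin': "slope_itinerary (circle_map (to_circle a') b') x' \<sigma>"
    and near: "\<bar>a' - a\<bar> \<le> \<eta>" "\<bar>b' - b\<bar> \<le> \<eta>"
    and b: "0 \<le> b" "b \<le> 1"
    and mono: "\<And>j. j < length \<sigma> \<Longrightarrow> multiplier b \<sigma> (Suc j) \<le> \<Lambda>"
    and \<Lambda>: "\<Lambda> = multiplier b \<sigma> (length \<sigma>)"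
    and \<eta>: "5 ^ length \<sigma> * (3 * \<eta>) < (1 - \<Lambda>) / 2"
  shows "(1 - \<Lambda>) * \<bar>circle_rep x' - circle_rep x\<bar> \<le> 5 ^ length \<sigma> * (3 * \<eta>)"
proof -
  let ?r = "orbit_rep (to_circle a) b x" and ?s = "orbit_rep (to_circle a') b' x'"
  let ?A = "\<lambda>b a j t. branch_slope b (\<sigma> ! j) * t + branch_offset b (\<sigma> ! j) + a"
  let ?e = "\<lambda>j. ?s j - ?r j"
  let ?d = "\<lambda>j. ?A b' a' j (?s j) - ?A b a j (?s j)"
  have "\<bar>?e (length \<sigma>) - multiplier b \<sigma> (length \<sigma>) * ?e 0\<bar> \<le> 5 ^ length \<sigma> * (3 * \<eta>)"
  proof (rule offset_tracking[where d = ?d and m = "\<lambda>j. branch_slope b (\<sigma> ! j)" and \<Lambda> = \<Lambda>])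
    have small: "\<bar>?e j\<bar> < 1/2" if "j < length \<sigma>" for j
      using open_arc_diff orbit_rep_in_open_arc[OF itin that] orbit_rep_in_open_arc[OF itin' that]
      by blast
    have "length \<sigma> > 0" using itin by (simp add: slope_itinerary_def exact_period_def)
    then show "\<bar>?e j\<bar> < 1/2" if "j \<le> length \<sigma>" for j
      using small[of j] small[of 0] that orbit_rep_period[OF itin] orbit_rep_period[OF itin']
      by (cases "j = length \<sigma>") auto
    show "?e (Suc j) - (branch_slope b (\<sigma> ! j) * ?e j + ?d j) \<in> \<int>" if "j < length \<sigma>" for j
      using Ints_diff[OF orbit_rep_Suc[OF itin' that] orbit_rep_Suc[OF itin that]]
      by (simp add: algebra_simps)
    show "0 \<le> branch_slope b (\<sigma> ! j) \<and> branch_slope b (\<sigma> ! j) \<le> 4" for j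
      using b by (cases "\<sigma> ! j") auto
    show "\<bar>?d j\<bar> \<le> 3 * \<eta>" if "j < length \<sigma>" for j
      using branch_perturbation[OF near, of "?s j"] orbit_rep_in_open_arc[OF itin' that] 
        open_arc_bounds by (meson less_imp_le)
    show "0 \<le> multiplier b \<sigma> (Suc j) \<and> multiplier b \<sigma> (Suc j) \<le> \<Lambda>" if "j < length \<sigma>" for j
      using mono[OF that] multiplier_nonneg[OF b] by blast
    show "0 \<le> 3 * \<eta>" using near by linarith
  qed (use \<eta> in \<open>auto simp: multiplier_Suc\<close>)
  then have "\<bar>(1 - \<Lambda>) * ?e 0\<bar> \<le> 5 ^ length \<sigma> * (3 * \<eta>)"
    using orbit_rep_period[OF itin] orbit_rep_period[OF itin'] \<Lambda> by (simp add: algebra_simps)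
  moreover have "?e 0 = circle_rep x' - circle_rep x" by (simp add: orbit_rep_def)
  moreover have "0 \<le> 1 - \<Lambda>" using \<eta> near
    by (smt (verit) divide_nonneg_nonneg half_gt_zero_iff mult_nonneg_nonneg zero_le_power)
  ultimately show ?thesis by (simp add: abs_mult)
qed

section \<open>Continuity of the marked point\<close>

lemma cycle_of_rotate:
  assumes "(f ^^ p) x = x" "y \<in> cycle_of f p x"
  shows "cycle_of f p x \<subseteq> cycle_of f p y"
proof
  fix z assume "z \<in> cycle_of f p x"
  then obtain k where k: "k < p" "z = (f ^^ k) x" by (auto simp: cycle_of_def)
  obtain i where i: "i < p" "y = (f ^^ i) x" using assms by (auto simp: cycle_of_def)
  show "z \<in> cycle_of f p y"
  proof (cases "i \<le> k")
    case True
    then have "z = (f ^^ (k - i)) y" using k i by (simp flip: funpow_add[unfolded o_def, THEN fun_cong])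
    then show ?thesis using k by (auto simp: cycle_of_def)
  next
    case False
    have "(f ^^ (k + p - i)) y = (f ^^ (k + p)) x"
      using k i by (simp flip: funpow_add[unfolded o_def, THEN fun_cong])
    also have "\<dots> = z" using k assms(1) by (simp add: funpow_add)
    finally show ?thesis using k i False by (auto simp: cycle_of_def intro!: rev_image_eqI[of "k + p - i"])
  qed
qed

text \<open>
  The slope on \<open>I\<^sub>+\<close> is at least 2. This is where the shape \<open>- + \<dots> +\<close> of the itinerary enters: the full
  product bounds all shorter nonempty ones.
\<close>

lemma multiplier_mono:
  assumes "0 \<le> b" "b \<le> 1" "\<And>j. 1 \<le> j \<Longrightarrow> j < p \<Longrightarrow> \<sigma> ! j = Plus" "1 \<le> j" "j \<le> p"
  shows "multiplier b \<sigma> j \<le> multiplier b \<sigma> p"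
  using assms(5,3)
proof (induction p rule: dec_induct)
  case base
  then show ?case by simp
next
  case (step n)
  have "multiplier b \<sigma> n \<le> branch_slope b (\<sigma> ! n) * multiplier b \<sigma> n"
    using step.prems[of n] step.hyps assms(1,2,4) multiplier_nonneg[OF assms(1,2), of \<sigma> n]
      mult_right_mono[of 1 "2 + 2 * b" "multiplier b \<sigma> n"] by simp
  moreover have "multiplier b \<sigma> j \<le> multiplier b \<sigma> n" using step by simp
  ultimately show ?case by (simp add: multiplier_Suc)
qed

text \<open>
  All points of the cycle but the initial one lie in \<open>I\<^sub>+\<close> and avoid its endpoints, so the initial
  point is the only one in \<open>I\<^sub>-\<close>.
\<close>

lemma marked_point_itinerary:
  assumes "length \<sigma> = p" "\<And>j. 1 \<le> j \<Longrightarrow> j < p \<Longrightarrow> \<sigma> ! j = Plus"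
    and C: "attracting_cycle_with (a, b) p \<sigma> C" and z: "z \<in> C" "z \<in> slope_arc Minus"
  shows "slope_itinerary (circle_map a b) z \<sigma>"
proof -
  let ?f = "circle_map a b"
  obtain x where x: "x \<in> C" "slope_itinerary ?f x \<sigma>"
    using C by (auto simp: attracting_cycle_with_def)
  obtain y where y: "(?f ^^ p) y = y" "C = cycle_of ?f p y"
    using C
    by (auto simp: attracting_cycle_with_def attracting_cycle_def periodic_cycle_def exact_period_def)
  then have "z \<in> cycle_of ?f p x" using cycle_of_rotate[OF y(1)] x(1) z(1) by blast
  then obtain j where j: "j < p" "z = (?f ^^ j) x" by (auto simp: cycle_of_def)
  have "j = 0"
  proof (rule ccontr)
    assume "j \<noteq> 0"
    then have "z \<in> slope_arc Plus" "z \<notin> {to_circle 0, to_circle (1/2)}"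
      using x(2) j assms(1) assms(2)[of j] by (auto simp: slope_itinerary_def)
    with z slope_arcs_disjoint show False by blast
  qed
  with j x show ?thesis by simp
qed

lemma marked_point_multiplier:
  assumes "length \<sigma> = p" "p \<ge> 1" "\<sigma> ! 0 = Minus" "0 \<le> b" "b \<le> 1"
    and C: "attracting_cycle_with (a, b) p \<sigma> C" and z: "z \<in> C"
    and itin: "slope_itinerary (circle_map a b) z \<sigma>"
  shows "multiplier b \<sigma> p < 1"
proof (cases "b = 1")
  case True
  then have "branch_slope b (\<sigma> ! 0) = 0" using assms by simp
  then have "multiplier b \<sigma> p = 0" using assms(2) by (auto simp: multiplier_def intro!: bexI[of _ 0])
  then show ?thesis by simp
next
  case False
  obtain U where "open U" "z \<in> U" "\<And>y. y \<in> U \<Longrightarrow> (\<lambda>n. ((circle_map a b ^^ p) ^^ n) y) \<longlonglongrightarrow> z"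
    using C z by (fastforce simp: attracting_cycle_with_def attracting_cycle_def)
  then show ?thesis
    using attracting_multiplier_less_1[OF itin, of U] assms False by auto
qed

theorem claim3p10:
  fixes p :: nat and \<sigma> :: "slope list"
    and S :: "(circle \<times> real) set" and \<Xi> :: "circle \<times> real \<Rightarrow> circle"
  assumes "p \<ge> 1" and "length \<sigma> = p"
    and "\<sigma> ! 0 = Minus" and "\<And>j. 1 \<le> j \<Longrightarrow> j \<le> p - 1 \<Longrightarrow> \<sigma> ! j = Plus"
    and "S \<in> components (attracting_params p \<sigma>)"
    and "\<And>ab. ab \<in> S \<Longrightarrow>
           \<exists>C. attracting_cycle_with ab p \<sigma> C \<and> \<Xi> ab \<in> C \<inter> slope_arc Minus"
  shows "continuous_on S \<Xi>"
proof -
  have plus: "\<sigma> ! j = Plus" if "1 \<le> j" "j < p" for j using assms(4) that by simp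
  have b_range: "0 \<le> b \<and> b \<le> 1" if "(a, b) \<in> S" for a b
    using in_components_subset[OF assms(5)] that by (auto simp: attracting_params_def)
  have itin: "slope_itinerary (circle_map a b) (\<Xi> (a, b)) \<sigma>" if "(a, b) \<in> S" for a b
    using assms(6)[OF that] marked_point_itinerary[OF assms(2) plus] by blast
  have mult: "multiplier b \<sigma> p < 1" if "(a, b) \<in> S" for a b
    using assms(6)[OF that] itin[OF that] b_range[OF that]
      marked_point_multiplier[OF assms(2,1,3)] by blast
  have "\<exists>W. open W \<and> ab \<in> W \<and> (\<forall>ab'\<in>S. ab' \<in> W \<longrightarrow> \<Xi> ab' \<in> V)"
    if ab: "ab \<in> S" and V: "open V" "\<Xi> ab \<in> V" for ab V
  proof -
    obtain \<alpha> b where \<alpha>: "ab = (to_circle \<alpha>, b)" by (metis surj_pair to_circle_rep)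
    let ?x = "\<Xi> ab" and ?\<Lambda> = "multiplier b \<sigma> p"
    have \<Lambda>: "?\<Lambda> < 1" using mult ab \<alpha> by blast
    obtain \<epsilon> where \<epsilon>: "\<epsilon> > 0" "\<And>s. \<bar>s - circle_rep ?x\<bar> < \<epsilon> \<Longrightarrow> to_circle s \<in> V"
      using open_circle_contains_arc[of V "circle_rep ?x"] V by auto
    \<comment> \<open>With \<open>1/2\<close> in the minimum the recursion is free of integer jumps, with \<open>\<epsilon>\<close> the marked point
      stays in \<open>V\<close>.\<close>
    define \<eta> where "\<eta> = (1 - ?\<Lambda>) * min (1/2) \<epsilon> / (6 * 5 ^ p)"
    have pos: "(1 - ?\<Lambda>) * min (1/2) \<epsilon> > 0" using \<Lambda> \<epsilon> by simp
    then have \<eta>: "\<eta> > 0" by (simp add: \<eta>_def)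
    have "5 ^ p * (3 * \<eta>) = (1 - ?\<Lambda>) * min (1/2) \<epsilon> / 2" by (simp add: \<eta>_def)
    also have "\<dots> < (1 - ?\<Lambda>) * min (1/2) \<epsilon>" using pos by simp
    finally have bound: "5 ^ p * (3 * \<eta>) < (1 - ?\<Lambda>) * min (1/2) \<epsilon>" .
    have half: "5 ^ p * (3 * \<eta>) < (1 - ?\<Lambda>) / 2"
      using bound mult_left_mono[of "min (1/2) \<epsilon>" "1/2" "1 - ?\<Lambda>"] \<Lambda> by linarith
    define W where "W = to_circle ` {\<alpha> - \<eta> <..< \<alpha> + \<eta>} \<times> {b - \<eta> <..< b + \<eta>}"
    have "open W" by (simp add: W_def open_Times open_to_circle_image)
    moreover have "ab \<in> W" using \<eta> by (auto simp: W_def \<alpha>)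
    moreover have "\<Xi> ab' \<in> V" if ab': "ab' \<in> S" "ab' \<in> W" for ab'
    proof -
      obtain \<alpha>' b' where \<alpha>': "ab' = (to_circle \<alpha>', b')" "\<bar>\<alpha>' - \<alpha>\<bar> \<le> \<eta>" "\<bar>b' - b\<bar> \<le> \<eta>"
        using ab'(2) by (auto simp: W_def)
      have "(1 - ?\<Lambda>) * \<bar>circle_rep (\<Xi> ab') - circle_rep ?x\<bar> \<le> 5 ^ length \<sigma> * (3 * \<eta>)"
        using itin[of "to_circle \<alpha>" b] itin[of "to_circle \<alpha>'" b'] ab ab'(1) \<alpha> \<alpha>' b_range half assms(2)
        by (intro itinerary_point_perturbation[where a = \<alpha> and a' = \<alpha>' and b = b and b' = b'])
           (auto intro!: multiplier_mono plus)
      also have "\<dots> < (1 - ?\<Lambda>) * min (1/2) \<epsilon>" using bound assms(2) by simp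
      finally have "\<bar>circle_rep (\<Xi> ab') - circle_rep ?x\<bar> < \<epsilon>"
        using \<Lambda> by (simp add: mult_less_cancel_left)
      then show ?thesis using \<epsilon>(2) by fastforce
    qed
    ultimately show ?thesis by blast
  qed
  then show ?thesis unfolding continuous_on_topological by blast
qed

end
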